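(* Let $f:[0,1]\to[0,1]$ be the Tent-map. 1. Let $\xi:[0,1]\to[0,1]$ be an arbitrary continuous solution of the functional equation $\xi\circ f=f\circ\xi$. Then $\xi$ has one of the following forms: (a) there exists $k\in\mathbb{N}$ such that for all $x\in[0,1]$ $$\xi(x)=\frac{1-(-1)^{[kx]}}{2}+(-1)^{[kx]}\{kx\};$$ (b) $\xi(x)=x_0$ for all $x\in[0,1]$, where either $x_0=0$ or $x_0=2/3$. 2. For every $k\in\mathbb{N}$ the function $\xi$ given by the formula in (a) satisfies $\xi\circ f=f\circ\xi$.
   Context: The Tent-map is $f:[0,1]\to[0,1]$, $f(x)=2x$ for $x<1/2$ and $f(x)=2-2x$ for $x\geq 1/2$. Here $\{\cdot\}$ denotes the fractional part of a number and $[\cdot]$ denotes the integer part. $\mathbb{N}=\{1,2,3,\dots\}$. *)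

theory Defs
  imports "HOL-Analysis.Analysis"
begin

(* Self-maps of the unit interval are total functions on the reals; only their values on
   {0..1} are meaningful. *)

definition tent :: "real \<Rightarrow> real" where
  "tent x = (if x < 1/2 then 2 * x else 2 - 2 * x)"

definition zigzag :: "nat \<Rightarrow> real \<Rightarrow> real" where
  "zigzag k x = (1 - (-1) powi \<lfloor>real k * x\<rfloor>) / 2 + (-1) powi \<lfloor>real k * x\<rfloor> * frac (real k * x)"

end

theory Submission
  imports Defs
begin

text \<open>
  Let \<open>tri\<close> be the triangle wave, the even 2-periodic extension of the identity of \<open>[0,1]\<close>. Then
  \<open>tent (tri y) = tri (2 * y)\<close> and \<open>zigzag k x = tri (k * x)\<close>, which gives part 2. For part 1, \<open>\<xi> 0\<close>
  is a fixed point \<open>p\<close> of the tent map. Linearizing the tent map at \<open>p\<close>, where its slope is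
  \<open>s = 2\<close> or \<open>s = -2\<close>, lifts \<open>\<xi> \<circ> tri\<close> to a continuous \<open>\<psi>\<close> on \<open>[0,\<infinity>)\<close> with \<open>\<psi> (2 * x) = s * \<psi> x\<close> and
  \<open>\<xi> (tri x) = tri (p + \<psi> x)\<close>. At the integers \<open>\<psi>\<close> takes values in a discrete group, and
  its increments over unit intervals are bounded by uniform continuity of \<open>\<xi>\<close>, so some
  \<open>[J,J+1]\<close> has an increment of maximal modulus. After rescaling by \<open>s ^ n\<close> the interval becomes a
  chain of \<open>2 ^ n\<close> unit intervals along which the increments can only add up to \<open>2 ^ n\<close> times the
  maximum if all are equal; hence \<open>\<psi>\<close> is affine on \<open>[J,J+1]\<close>. As \<open>tri\<close> maps \<open>[J,J+1]\<close>
  isometrically onto \<open>[0,1]\<close>, \<open>\<xi> t = tri (a + b * t)\<close>, and the functional equation fixes \<open>a\<close> and \<open>b\<close>.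
\<close>

section \<open>The triangle wave and its symmetries\<close>

definition tri :: "real \<Rightarrow> real" where
  "tri y = arccos (cos (pi * y)) / pi"

lemma tri_nonneg: "0 \<le> tri y" and tri_le_1: "tri y \<le> 1"
  using arccos_bounded[of "cos (pi * y)"] by (auto simp: tri_def divide_simps)

lemma cos_tri: "cos (pi * tri y) = cos (pi * y)"
  by (simp add: tri_def)

lemma tri_eq_iff: "tri y = tri z \<longleftrightarrow> cos (pi * y) = cos (pi * z)"
  by (metis cos_tri tri_def)

lemma tri_id: "0 \<le> y \<Longrightarrow> y \<le> 1 \<Longrightarrow> tri y = y"
  by (simp add: tri_def arccos_cos mult_left_le)

lemma tri_eqD:
  assumes "tri y = tri z"
  obtains m :: int where "y = z + 2 * of_int m \<or> y = - z + 2 * of_int m"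
proof -
  obtain n where "n \<in> \<int>" "pi * y = pi * z + 2 * n * pi \<or> pi * y = - (pi * z) + 2 * n * pi"
    using assms unfolding tri_eq_iff cos_eq by blast
  moreover from this obtain m :: int where "n = of_int m"
    by (auto elim: Ints_cases)
  moreover have "pi * z + 2 * n * pi = pi * (z + 2 * n)" "- (pi * z) + 2 * n * pi = pi * (- z + 2 * n)"
    by (simp_all add: algebra_simps)
  ultimately have "y = z + 2 * of_int m \<or> y = - z + 2 * of_int m"
    by simp
  then show thesis by (rule that)
qed

lemma tri_add_even [simp]: "tri (y + 2 * of_int m) = tri y"
  unfolding tri_eq_iff cos_eq
  by (rule bexI[of _ "of_int m"]) (auto simp: algebra_simps)

lemma tri_minus [simp]: "tri (- y) = tri y"
  by (simp add: tri_def)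

text \<open>\<open>tri\<close> depends only on the cosine, and cos (2 u) is a polynomial in cos u,
  so replacing \<open>y\<close> by \<open>tri y\<close> before doubling changes nothing.\<close>

lemma tri_double: "tri (2 * tri y) = tri (2 * y)"
proof -
  have "cos (pi * (2 * z)) = 2 * (cos (pi * z))\<^sup>2 - 1" for z
    using cos_double_cos[of "pi * z"] by (simp add: ac_simps)
  then show ?thesis by (simp add: tri_eq_iff cos_tri)
qed

lemma tri_reflect: "tri (2 - y) = tri y"
  using tri_add_even[of "- y" 1] by simp

lemma tri_of_int_add:
  assumes "0 \<le> t" "t \<le> 1"
  shows "tri (of_int m + t) = (if even m then t else 1 - t)"
proof (cases "even m")
  case True
  then obtain k where "m = 2 * k" by blast
  then show ?thesis using assms tri_add_even[of t k] by (simp add: add.commute tri_id)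
next
  case False
  then obtain k where "m = 2 * k + 1" by (elim oddE)
  then show ?thesis
    using assms tri_add_even[of "1 + t" k] tri_reflect[of "1 + t"] by (simp add: algebra_simps tri_id)
qed

section \<open>The tent map and the zigzag maps expressed by the triangle wave\<close>

lemma tent_eq_tri: "0 \<le> y \<Longrightarrow> y \<le> 1 \<Longrightarrow> tent y = tri (2 * y)"
  using tri_reflect[of "2 * y"] by (auto simp: tent_def tri_id)

lemma tent_tri: "tent (tri y) = tri (2 * y)"
  by (simp add: tent_eq_tri tri_nonneg tri_le_1 tri_double)

text \<open>The parity of the integer part decides whether the wave rises or falls there; the powers
  of -1 in \<open>zigzag\<close> encode exactly this choice.\<close>

lemma zigzag_eq_tri: "zigzag k x = tri (real k * x)"
proof -
  have "tri (real k * x) = tri (of_int \<lfloor>real k * x\<rfloor> + frac (real k * x))"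
    by (simp add: frac_def)
  also have "\<dots> = (if even \<lfloor>real k * x\<rfloor> then frac (real k * x) else 1 - frac (real k * x))"
    by (rule tri_of_int_add) (auto simp: frac_ge_0 frac_lt_1 less_imp_le)
  also have "\<dots> = zigzag k x"
    by (simp add: zigzag_def power_int_minus_left_even power_int_minus_left_odd)
  finally show ?thesis ..
qed

lemma zigzag_tent:
  assumes "0 \<le> x" "x \<le> 1"
  shows "zigzag k (tent x) = tent (zigzag k x)"
proof -
  \<comment> \<open>On the falling branch the argument is 2 k - 2 k x, which evenness and the even
    shift 2 k identify with 2 k x; so both branches agree.\<close>
  have "tri (real k * (2 - 2 * x)) = tri (real k * (2 * x))"
    using tri_add_even[of "- (real k * (2 * x))" "int k"] by (simp add: algebra_simps)
  then have "tri (real k * tent x) = tri (real k * (2 * x))"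
    by (auto simp: tent_def)
  then show ?thesis
    by (simp add: zigzag_eq_tri tent_tri ac_simps)
qed

section \<open>Oscillation bounds, extremal sums and dyadic approximation\<close>

text \<open>An oscillation of at least 2 would cover two consecutive integers, where \<open>tri\<close> is 0 and 1.\<close>

lemma tri_lift_oscillation:
  fixes g :: "real \<Rightarrow> real"
  assumes cont: "continuous_on {u..v} g" and "u \<le> v"
    and close: "\<And>x y. x \<in> {u..v} \<Longrightarrow> y \<in> {u..v} \<Longrightarrow> \<bar>tri (g x) - tri (g y)\<bar> < 1"
  shows "\<bar>g v - g u\<bar> < 2"
proof (rule ccontr)
  assume far: "\<not> \<bar>g v - g u\<bar> < 2"
  define a where "a = min (g u) (g v)"
  define b where "b = max (g u) (g v)"
  have conn: "connected (g ` {u..v})"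
    by (intro connected_continuous_image cont connected_Icc)
  have ab: "a \<in> g ` {u..v}" "b \<in> g ` {u..v}"
    using \<open>u \<le> v\<close> by (auto simp: a_def b_def min_def max_def)
  have hit: "z \<in> g ` {u..v}" if "a \<le> z" "z \<le> b" for z
    using connectedD_interval[OF conn ab that] .
  have "b - a \<ge> 2" using far by (auto simp: a_def b_def)
  define m where "m = \<lceil>a\<rceil>"
  have m: "a \<le> of_int m" "of_int m + 1 \<le> b"
    using \<open>b - a \<ge> 2\<close> unfolding m_def by linarith+
  obtain x where x: "x \<in> {u..v}" "g x = of_int m"
    using hit[of "of_int m"] m by force
  obtain y where y: "y \<in> {u..v}" "g y = of_int m + 1"
    using hit[of "of_int m + 1"] m by force
  have "\<bar>tri (g x) - tri (g y)\<bar> = 1"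
    using tri_of_int_add[of 0 m] tri_of_int_add[of 1 m] x y by (auto split: if_splits)
  then show False using close[OF x(1) y(1)] by simp
qed

lemma telescope_bound:
  fixes f :: "nat \<Rightarrow> real"
  assumes "\<And>j. j < n \<Longrightarrow> \<bar>f (Suc j) - f j\<bar> \<le> K"
  shows "\<bar>f n - f 0\<bar> \<le> real n * K"
  using assms
proof (induction n)
  case (Suc n)
  have "\<bar>f n - f 0\<bar> \<le> real n * K" using Suc by simp
  moreover have "\<bar>f (Suc n) - f n\<bar> \<le> K" using Suc.prems by simp
  ultimately show ?case by (simp add: algebra_simps abs_le_iff)
qed simp

text \<open>The stretches from 0 to \<open>i\<close> and from \<open>i\<close> to \<open>n\<close>
  each contribute at most their share in the direction of \<open>d\<close>; a full total leaves no
  slack in either.\<close>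

lemma telescope_extremal:
  fixes f :: "nat \<Rightarrow> real"
  assumes step: "\<And>j. \<bar>f (Suc j) - f j\<bar> \<le> \<bar>d\<bar>"
    and total: "f n - f 0 = real n * d" and "i \<le> n"
  shows "f i - f 0 = real i * d"
proof -
  have "\<bar>f i - f 0\<bar> \<le> real i * \<bar>d\<bar>"
    using telescope_bound[of i f "\<bar>d\<bar>"] step by simp
  moreover have "\<bar>f n - f i\<bar> \<le> real (n - i) * \<bar>d\<bar>"
    using telescope_bound[of "n - i" "\<lambda>j. f (i + j)" "\<bar>d\<bar>"] step \<open>i \<le> n\<close> by simp
  moreover have "real n * d = real i * d + real (n - i) * d"
    using \<open>i \<le> n\<close> by (simp add: of_nat_diff algebra_simps)
  ultimately show ?thesis
    using total by (cases "d \<ge> 0") (auto simp: abs_le_iff)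
qed

lemma linear_if_linear_on_dyadics:
  fixes g :: "real \<Rightarrow> real"
  assumes cont: "continuous_on {0..1} g"
    and dyadic: "\<And>n i :: nat. i \<le> 2 ^ n \<Longrightarrow> g (real i / 2 ^ n) = a + real i / 2 ^ n * d"
    and t: "0 \<le> t" "t \<le> 1"
  shows "g t = a + t * d"
proof -
  \<comment> \<open>\<open>q n\<close> is \<open>t\<close> rounded down to the grid of mesh 1 / 2^n,
    hence converges to \<open>t\<close>.\<close>
  define i where "i n = nat \<lfloor>2 ^ n * t\<rfloor>" for n :: nat
  define q where "q n = real (i n) / 2 ^ n" for n
  have i: "real (i n) \<le> 2 ^ n * t" "2 ^ n * t < real (i n) + 1" for n
    using t unfolding i_def by (simp_all add: of_nat_nat)
  have "2 ^ n * t \<le> 2 ^ n" for n using t by (simp add: mult_left_le)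
  then have "real (i n) \<le> 2 ^ n" for n using i(1)[of n] by (rule order_trans[rotated])
  then have i_le: "i n \<le> 2 ^ n" for n by (metis of_nat_le_iff of_nat_numeral of_nat_power)
  have q01: "q n \<in> {0..1}" for n
    using \<open>\<And>n. real (i n) \<le> 2 ^ n\<close>[of n] by (simp add: q_def)
  have "\<bar>q n - t\<bar> \<le> (1 / 2) ^ n" for n
  proof -
    have "q n \<le> t" "t < q n + (1 / 2) ^ n"
      using i[of n]
      by (simp_all add: q_def power_one_over divide_le_eq less_divide_eq mult.commute flip: add_divide_distrib)
    then show ?thesis by simp
  qed
  then have "(\<lambda>n. q n - t) \<longlonglongrightarrow> 0"
    by (intro Lim_null_comparison[OF _ LIMSEQ_power_zero[of "1/2::real"]]) auto
  then have q: "q \<longlonglongrightarrow> t"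
    by (rule LIM_zero_cancel)
  have "(\<lambda>n. g (q n)) \<longlonglongrightarrow> g t"
    by (rule continuous_on_tendsto_compose[OF cont q]) (use q01 t in auto)
  moreover have "(\<lambda>n. g (q n)) = (\<lambda>n. a + q n * d)"
    using dyadic[OF i_le] by (auto simp: q_def)
  moreover have "(\<lambda>n. a + q n * d) \<longlonglongrightarrow> a + t * d"
    by (intro tendsto_intros q)
  ultimately show ?thesis
    using LIMSEQ_unique by metis
qed

section \<open>Affinity of a scaling lift on some unit interval\<close>

lemma scaling_lift_linear:
  fixes \<psi> :: "real \<Rightarrow> real" and c s :: real
  assumes cont: "\<And>R. continuous_on {0..R} \<psi>"
    and scale: "\<And>x. 0 \<le> x \<Longrightarrow> \<psi> (2 * x) = s * \<psi> x" and s: "\<bar>s\<bar> = 2"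
    and discrete: "\<And>j::nat. c * \<psi> (real j) \<in> \<int>" and "c > 0"
    and bounded: "\<And>j::nat. \<bar>\<psi> (real (Suc j)) - \<psi> (real j)\<bar> \<le> B"
  obtains J :: nat and a d where "\<And>t. 0 \<le> t \<Longrightarrow> t \<le> 1 \<Longrightarrow> \<psi> (real J + t) = a + t * d"
proof -
  define \<Delta> where "\<Delta> j = \<psi> (real (Suc j)) - \<psi> (real j)" for j
  \<comment> \<open>The numbers c * |\<open>\<Delta> j\<close>| are integers; as a bounded sequence
    of naturals they attain a maximum, at \<open>J\<close>.\<close>
  define h where "h j = nat \<lfloor>c * \<bar>\<Delta> j\<bar>\<rfloor>" for j
  have "c * \<Delta> j \<in> \<int>" for j
    using Ints_diff[OF discrete discrete, of "Suc j" j] by (simp add: \<Delta>_def right_diff_distrib)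
  then have "c * \<bar>\<Delta> j\<bar> \<in> \<int>" for j
    using \<open>c > 0\<close> Ints_abs[of "c * \<Delta> j"] by (simp add: abs_mult)
  then have h: "real (h j) = c * \<bar>\<Delta> j\<bar>" for j
    using \<open>c > 0\<close> by (auto simp: h_def of_nat_nat elim!: Ints_cases)
  have "real (h j) \<le> c * B" for j
    using bounded[of j] \<open>c > 0\<close> by (simp add: h \<Delta>_def)
  then have "h j < nat \<lceil>c * B\<rceil> + 1" for j
    by (metis le_nat_floor less_Suc_eq_le Suc_eq_plus1 of_nat_ceiling of_nat_le_iff order_trans)
  then obtain J where "h j \<le> h J" for j
    using Lattices_Big.ex_has_greatest_nat[of "\<lambda>_. True" _ h "nat \<lceil>c * B\<rceil> + 1"] by auto
  then have max: "\<bar>\<Delta> j\<bar> \<le> \<bar>\<Delta> J\<bar>" for j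
    using h \<open>c > 0\<close> by (metis mult_le_cancel_left_pos of_nat_le_iff)
  have scale_pow: "\<psi> (2 ^ n * x) = s ^ n * \<psi> x" if "0 \<le> x" for n x
  proof (induction n)
    case (Suc n)
    then show ?case using scale[of "2 ^ n * x"] that by (simp add: ac_simps)
  qed simp
  have s0: "s \<noteq> 0" and s_pow: "\<bar>s ^ n\<bar> = 2 ^ n" for n
    using s by (auto simp: power_abs)
  have dyadic: "\<psi> (real J + real i / 2 ^ n) = \<psi> (real J) + real i / 2 ^ n * \<Delta> J"
    if "i \<le> 2 ^ n" for n i :: nat
  proof -
    \<comment> \<open>Scaling by 2^n sends the grid points J + j / 2^n to consecutive integers, so
      steps of \<open>f\<close> are again increments \<open>\<Delta>\<close>. The mean step
      \<open>d\<close> has modulus |\<open>\<Delta> J\<close>| because |s| = 2, so it is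
      extremal.\<close>
    define f where "f j = \<psi> (real (2 ^ n * J + j))" for j
    define d where "d = s ^ n * \<Delta> J / 2 ^ n"
    have f: "f j = s ^ n * \<psi> (real J + real j / 2 ^ n)" for j
    proof -
      have "real (2 ^ n * J + j) = 2 ^ n * (real J + real j / 2 ^ n)"
        by (simp add: distrib_left)
      then show ?thesis using scale_pow[of "real J + real j / 2 ^ n" n] by (simp add: f_def)
    qed
    have "\<bar>d\<bar> = \<bar>\<Delta> J\<bar>" by (simp add: d_def abs_mult s_pow)
    then have "\<bar>f (Suc j) - f j\<bar> \<le> \<bar>d\<bar>" for j
      using max[of "2 ^ n * J + j"] by (simp add: f_def \<Delta>_def)
    moreover have "f (2 ^ n) - f 0 = real (2 ^ n) * d"
    proof -
      have "real (2 ^ n) * d = s ^ n * \<Delta> J" by (simp add: d_def)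
      then show ?thesis by (simp add: f \<Delta>_def right_diff_distrib add.commute)
    qed
    ultimately have "f i - f 0 = real i * d"
      using telescope_extremal that by blast
    then have "s ^ n * (\<psi> (real J + real i / 2 ^ n) - \<psi> (real J)) = s ^ n * (real i / 2 ^ n * \<Delta> J)"
      by (simp add: f d_def algebra_simps)
    then have "\<psi> (real J + real i / 2 ^ n) - \<psi> (real J) = real i / 2 ^ n * \<Delta> J"
      using s0 by (simp only: mult_cancel_left power_eq_0_iff) simp
    then show ?thesis by simp
  qed
  have "continuous_on {0..1} (\<lambda>t. \<psi> (real J + t))"
    by (rule continuous_on_compose2[OF cont[of "real J + 1"]]) (auto intro!: continuous_intros)
  from linear_if_linear_on_dyadics[OF this dyadic] that show thesis by blast
qed

section \<open>Lifting a continuous solution through the triangle wave\<close>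

locale tent_commuting =
  fixes \<xi> :: "real \<Rightarrow> real"
  assumes range: "x \<in> {0..1} \<Longrightarrow> \<xi> x \<in> {0..1}"
    and cont: "continuous_on {0..1} \<xi>"
    and comm: "x \<in> {0..1} \<Longrightarrow> \<xi> (tent x) = tent (\<xi> x)"
begin

lemma value_0: "\<xi> 0 = 0 \<or> \<xi> 0 = 2 / 3"
  using comm[of 0] by (auto simp: tent_def split: if_splits)

text \<open>The derivative of the tent map at its fixed point \<open>\<xi> 0\<close>.\<close>

definition slope :: real where
  "slope = (if \<xi> 0 = 0 then 2 else - 2)"

lemma slope_cases: "slope = 2 \<or> slope = - 2" and abs_slope: "\<bar>slope\<bar> = 2"
  by (auto simp: slope_def)

lemma extension_double: "\<xi> (tri (2 * y)) = tri (slope * \<xi> (tri y))"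
proof -
  have "tri y \<in> {0..1}" by (simp add: tri_nonneg tri_le_1)
  with comm[OF this] range[OF this] have "\<xi> (tri (2 * y)) = tri (2 * \<xi> (tri y))"
    by (simp add: tent_tri tent_eq_tri)
  then show ?thesis
    using slope_cases tri_minus[of "2 * \<xi> (tri y)"] by auto
qed

lemma tri_slope_tri: "tri (slope * tri y) = tri (slope * y)"
  using slope_cases tri_double[of y] tri_minus[of "2 * tri y"] tri_minus[of "2 * y"] by auto

lemma extension_power: "\<xi> (tri (2 ^ n * y)) = tri (slope ^ n * \<xi> (tri y))"
proof (induction n)
  case 0
  then show ?case using range[of "tri y"] by (simp add: tri_nonneg tri_le_1 tri_id)
next
  case (Suc n)
  then show ?case
    using extension_double[of "2 ^ n * y"] tri_slope_tri[of "slope ^ n * \<xi> (tri y)"]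
    by (simp add: ac_simps)
qed

text \<open>Multiplication by \<open>slope\<close> fixes \<open>\<xi> 0\<close> modulo the period 2
  of \<open>tri\<close>: -2 * (2/3) = 2/3 - 2. This lets the lift be centred at
  \<open>\<xi> 0\<close>.\<close>

lemma slope_power_value_0: "\<exists>m::int. slope ^ n * \<xi> 0 = \<xi> 0 + 2 * of_int m"
proof (cases "\<xi> 0 = 0")
  case True
  then show ?thesis by (auto intro: exI[of _ 0])
next
  case False
  then have eq: "\<xi> 0 = 2 / 3" "slope = - 2" using value_0 by (auto simp: slope_def)
  show ?thesis
  proof (induction n)
    case 0
    then show ?case by (auto intro: exI[of _ 0])
  next
    case (Suc n)
    then obtain m :: int where m: "slope ^ n * \<xi> 0 = \<xi> 0 + 2 * of_int m" by blast
    have "slope ^ Suc n * \<xi> 0 = slope * (\<xi> 0 + 2 * of_int m)"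
      using m by simp
    also have "\<dots> = \<xi> 0 + 2 * of_int (- 1 - 2 * m)"
      by (simp add: eq)
    finally show ?case by blast
  qed
qed

lemma linearizable_at_0:
  obtains \<delta> where "\<delta> > 0" "2 * \<delta> \<le> 1"
    "\<And>x. 0 \<le> x \<Longrightarrow> x \<le> \<delta> \<Longrightarrow> \<xi> (2 * x) - \<xi> 0 = slope * (\<xi> x - \<xi> 0)"
proof -
  \<comment> \<open>1/6 is the distance from the fixed point 2/3 to the kink 1/2; within it the tent
    map is affine around either fixed point.\<close>
  obtain e where "e > 0" and e: "\<And>x. x \<in> {0..1} \<Longrightarrow> dist x 0 < e \<Longrightarrow> dist (\<xi> x) (\<xi> 0) < 1 / 6"
    using cont[unfolded continuous_on_iff, rule_format, of 0 "1/6"] by auto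
  define \<delta> where "\<delta> = min (e / 2) (1 / 4)"
  show thesis
  proof
    show "\<delta> > 0" "2 * \<delta> \<le> 1" using \<open>e > 0\<close> by (auto simp: \<delta>_def)
    fix x assume x: "0 \<le> x" "x \<le> \<delta>"
    then have "\<bar>\<xi> x - \<xi> 0\<bar> < 1 / 6" "tent x = 2 * x" "x \<in> {0..1}"
      using e[of x] \<open>e > 0\<close> by (auto simp: \<delta>_def tent_def dist_real_def)
    then show "\<xi> (2 * x) - \<xi> 0 = slope * (\<xi> x - \<xi> 0)"
      using comm[of x] value_0 by (auto simp: tent_def slope_def)
  qed
qed

lemma lift:
  obtains \<psi> where "\<And>R. continuous_on {0..R} \<psi>"
    "\<And>x. 0 \<le> x \<Longrightarrow> \<psi> (2 * x) = slope * \<psi> x"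
    "\<And>x. 0 \<le> x \<Longrightarrow> tri (\<xi> 0 + \<psi> x) = \<xi> (tri x)"
proof -
  obtain \<delta> where \<delta>: "\<delta> > 0" "2 * \<delta> \<le> 1"
    and lin: "\<And>x. 0 \<le> x \<Longrightarrow> x \<le> \<delta> \<Longrightarrow> \<xi> (2 * x) - \<xi> 0 = slope * (\<xi> x - \<xi> 0)"
    by (rule linearizable_at_0) blast
  text \<open>By the choice of \<open>\<delta>\<close>, \<open>L n x\<close> does not depend on \<open>n\<close> as soon as \<open>x \<le> 2 ^ n * \<delta>\<close>; this value is \<open>\<psi> x\<close>.\<close>
  define L where "L n x = slope ^ n * (\<xi> (x / 2 ^ n) - \<xi> 0)" for n x
  have ex: "\<exists>n. x \<le> 2 ^ n * \<delta>" for x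
  proof -
    obtain n where "x / \<delta> < 2 ^ n" using real_arch_pow[of 2 "x / \<delta>"] by auto
    then show ?thesis using \<delta> by (auto simp: field_simps intro!: exI[of _ n])
  qed
  define N where "N x = (LEAST n. x \<le> 2 ^ n * \<delta>)" for x
  have N: "x \<le> 2 ^ N x * \<delta>" for x
    unfolding N_def using ex LeastI_ex by fast
  define \<psi> where "\<psi> x = L (N x) x" for x
  have step: "L (n + k) x = L n x" if "0 \<le> x" "x \<le> 2 ^ n * \<delta>" for n k x
  proof (induction k)
    case (Suc k)
    define y where "y = x / 2 ^ Suc (n + k)"
    have "x / 2 ^ (n + k) \<le> x / 2 ^ n"
      using that by (intro divide_left_mono) (auto simp: power_increasing)
    also have "\<dots> \<le> \<delta>" using that by (simp add: field_simps)
    finally have "0 \<le> y" "y \<le> \<delta>" using that \<delta> by (auto simp: y_def)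
    moreover have "2 * y = x / 2 ^ (n + k)" by (simp add: y_def)
    ultimately have "\<xi> (x / 2 ^ (n + k)) - \<xi> 0 = slope * (\<xi> y - \<xi> 0)"
      using lin[of y] by simp
    then have "L (n + k) x = L (Suc (n + k)) x" by (simp add: L_def y_def)
    with Suc show ?case by simp
  qed simp
  have \<psi>: "\<psi> x = L n x" if "0 \<le> x" "x \<le> 2 ^ n * \<delta>" for n x
  proof -
    have "N x \<le> n" unfolding N_def using that by (intro Least_le)
    then show ?thesis using step[OF that(1) N, of "n - N x"] by (simp add: \<psi>_def)
  qed
  show thesis
  proof
    fix R
    obtain n where n: "R \<le> 2 ^ n * \<delta>" using ex by blast
    \<comment> \<open>A single index \<open>n\<close> serves all of [0,R], so continuity of
      \<open>\<psi>\<close> reduces to that of \<open>L n\<close>.\<close>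
    have "continuous_on {0..R} (L n)"
      unfolding L_def
    proof (intro continuous_intros continuous_on_compose2[OF cont])
      have "x / 2 ^ n \<le> 1" if "x \<le> R" for x
      proof -
        have "x / 2 ^ n \<le> \<delta>" using that n by (simp add: field_simps)
        then show ?thesis using \<delta> by linarith
      qed
      then show "(\<lambda>x. x / 2 ^ n) ` {0..R} \<subseteq> {0..1}" by auto
    qed auto
    moreover have "L n x = \<psi> x" if "x \<in> {0..R}" for x
      using that n by (intro \<psi>[symmetric]) auto
    ultimately show "continuous_on {0..R} \<psi>"
      using continuous_on_cong by blast
  next
    fix x :: real assume "0 \<le> x"
    obtain n where n: "x \<le> 2 ^ n * \<delta>" using ex by blast
    have "\<psi> (2 * x) = L (Suc n) (2 * x)" using \<open>0 \<le> x\<close> n by (intro \<psi>) auto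
    moreover have "\<psi> x = L n x" using \<open>0 \<le> x\<close> n by (intro \<psi>) auto
    ultimately show "\<psi> (2 * x) = slope * \<psi> x" by (simp add: L_def)
    have y: "x / 2 ^ n \<in> {0..1}"
    proof -
      have "x / 2 ^ n \<le> \<delta>" using n by (simp add: field_simps)
      then have "x / 2 ^ n \<le> 1" using \<delta> by linarith
      then show ?thesis using \<open>0 \<le> x\<close> by simp
    qed
    obtain m :: int where m: "slope ^ n * \<xi> 0 = \<xi> 0 + 2 * of_int m"
      using slope_power_value_0 by blast
    have "\<xi> (tri x) = tri (slope ^ n * \<xi> (x / 2 ^ n))"
      using extension_power[of n "x / 2 ^ n"] y by (simp add: tri_id)
    also have "slope ^ n * \<xi> (x / 2 ^ n) = (\<xi> 0 + \<psi> x) + 2 * of_int m"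
      using m \<open>\<psi> x = L n x\<close> by (simp add: L_def algebra_simps)
    finally show "tri (\<xi> 0 + \<psi> x) = \<xi> (tri x)" by simp
  qed
qed

section \<open>Continuous solutions as triangle waves of affine maps\<close>

lemma tri_linear:
  obtains a b where "\<And>t. 0 \<le> t \<Longrightarrow> t \<le> 1 \<Longrightarrow> \<xi> t = tri (a + b * t)"
proof -
  obtain \<psi> where \<psi>: "\<And>R. continuous_on {0..R} \<psi>"
    "\<And>x. 0 \<le> x \<Longrightarrow> \<psi> (2 * x) = slope * \<psi> x"
    "\<And>x. 0 \<le> x \<Longrightarrow> tri (\<xi> 0 + \<psi> x) = \<xi> (tri x)"
    by (rule lift) blast
  have tri_nat: "tri (real j + t) = (if even j then t else 1 - t)" if "0 \<le> t" "t \<le> 1" for j t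
    using tri_of_int_add[OF that, of "int j"] by simp
  \<comment> \<open>Since \<open>tri\<close> vanishes at 2 j, \<open>\<psi> (2 * real j)\<close> is
    an even integer, possibly minus 4/3. The factor 3 clears the denominator; another 2 comes from
    passing back to \<open>j\<close> by the scaling law.\<close>
  have discrete: "6 * \<psi> (real j) \<in> \<int>" for j
  proof -
    have "tri (\<xi> 0 + \<psi> (2 * real j)) = tri (\<xi> 0)"
      using \<psi>(3)[of "2 * real j"] tri_nat[of 0 "2 * j"] range[of 0] by (simp add: tri_id)
    then obtain m :: int where
      "\<xi> 0 + \<psi> (2 * real j) = \<xi> 0 + 2 * of_int m \<or> \<xi> 0 + \<psi> (2 * real j) = - \<xi> 0 + 2 * of_int m"
      by (rule tri_eqD)
    then have "3 * \<psi> (2 * real j) \<in> {of_int (6 * m), of_int (6 * m - 4)}"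
      using value_0 by auto
    then have "3 * \<psi> (2 * real j) \<in> \<int>" by auto
    then have "3 * (slope * \<psi> (real j)) \<in> \<int>" by (simp add: \<psi>(2))
    then show ?thesis using slope_cases by auto
  qed
  obtain e where "e > 0" and e: "\<And>x y. x \<in> {0..1} \<Longrightarrow> y \<in> {0..1} \<Longrightarrow> \<bar>x - y\<bar> < e \<Longrightarrow> \<bar>\<xi> x - \<xi> y\<bar> < 1"
    using compact_uniformly_continuous[OF cont compact_Icc, unfolded uniformly_continuous_on_def, rule_format, of 1]
    unfolding dist_real_def by (metis abs_minus_commute zero_less_one)
  obtain q :: nat where q: "0 < q" "1 / real q < e"
    using \<open>e > 0\<close> by (metis nat_approx_posE of_nat_Suc zero_less_Suc)
  \<comment> \<open>Cut [j,j+1] into \<open>q\<close> pieces shorter than \<open>e\<close>. On each,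
    \<open>\<xi> (tri x)\<close> varies by less than 1, so its lift moves by less than 2.\<close>
  have bounded: "\<bar>\<psi> (real (Suc j)) - \<psi> (real j)\<bar> \<le> real q * 2" for j
  proof -
    define f where "f i = \<psi> (real j + real i / real q)" for i
    have "\<bar>f (Suc i) - f i\<bar> \<le> 2" if "i < q" for i
    proof -
      define u where "u = real j + real i / real q"
      define v where "v = real j + real (Suc i) / real q"
      have uv: "real j \<le> u" "u \<le> v" "v \<le> real j + 1" "v - u < e"
        using q that by (auto simp: u_def v_def field_simps)
      have "\<bar>(\<xi> 0 + \<psi> v) - (\<xi> 0 + \<psi> u)\<bar> < 2"
      proof (rule tri_lift_oscillation[OF _ \<open>u \<le> v\<close>])
        show "continuous_on {u..v} (\<lambda>x. \<xi> 0 + \<psi> x)"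
          by (intro continuous_intros continuous_on_subset[OF \<psi>(1)[of v]]) (use uv in auto)
        fix x y assume xy: "x \<in> {u..v}" "y \<in> {u..v}"
        have "\<bar>tri x - tri y\<bar> = \<bar>x - y\<bar>"
          using tri_nat[of "x - real j" j] tri_nat[of "y - real j" j] xy uv by auto
        also have "\<dots> < e" using xy uv by auto
        finally have "\<bar>\<xi> (tri x) - \<xi> (tri y)\<bar> < 1"
          by (intro e) (simp_all add: tri_nonneg tri_le_1)
        then show "\<bar>tri (\<xi> 0 + \<psi> x) - tri (\<xi> 0 + \<psi> y)\<bar> < 1"
          using xy uv by (simp add: \<psi>(3))
      qed
      then show ?thesis by (simp add: f_def u_def v_def)
    qed
    then show ?thesis
      using telescope_bound[of q f 2] q by (simp add: f_def add.commute)
  qed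
  obtain J :: nat and a d where J: "\<And>t. 0 \<le> t \<Longrightarrow> t \<le> 1 \<Longrightarrow> \<psi> (real J + t) = a + t * d"
    using scaling_lift_linear[OF \<psi>(1,2) abs_slope discrete _ bounded] by (metis zero_less_numeral)
  have eq: "tri (\<xi> 0 + (a + t * d)) = \<xi> (tri (real J + t))" if "0 \<le> t" "t \<le> 1" for t
    using \<psi>(3)[of "real J + t"] J[OF that] that by simp
  show thesis
  proof (cases "even J")
    case True
    show thesis
      by (rule that[of "\<xi> 0 + a" d]) (use True eq tri_nat in \<open>simp add: algebra_simps\<close>)
  next
    case False
    \<comment> \<open>For odd \<open>J\<close> the wave falls on [J,J+1], so the parameter is
      reversed to 1 - t.\<close>
    have "\<xi> t = tri (\<xi> 0 + a + d + (- d) * t)" if "0 \<le> t" "t \<le> 1" for t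
      using eq[of "1 - t"] tri_nat[of "1 - t" J] False that by (simp add: algebra_simps)
    then show thesis by (rule that)
  qed
qed

section \<open>Determination of the affine coefficients\<close>

lemma classification:
  "(\<exists>k::nat. k \<ge> 1 \<and> (\<forall>x\<in>{0..1}. \<xi> x = zigzag k x)) \<or>
   (\<exists>x0::real. (x0 = 0 \<or> x0 = 2/3) \<and> (\<forall>x\<in>{0..1}. \<xi> x = x0))"
proof -
  obtain a b0 where ab: "\<And>t. 0 \<le> t \<Longrightarrow> t \<le> 1 \<Longrightarrow> \<xi> t = tri (a + b0 * t)"
    by (rule tri_linear) blast
  have "tri a = tri (\<xi> 0)"
    using ab[of 0] range[of 0] by (simp add: tri_id)
  then obtain m :: int where m: "a = \<xi> 0 + 2 * of_int m \<or> a = - \<xi> 0 + 2 * of_int m"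
    by (rule tri_eqD)
  \<comment> \<open>Periodicity and evenness of \<open>tri\<close> normalize the constant term to
    \<open>\<xi> 0\<close>, possibly flipping the sign of the coefficient.\<close>
  obtain b where b: "\<And>t. 0 \<le> t \<Longrightarrow> t \<le> 1 \<Longrightarrow> \<xi> t = tri (\<xi> 0 + b * t)"
  proof (cases "a = \<xi> 0 + 2 * of_int m")
    case True
    have "tri (a + b0 * t) = tri (\<xi> 0 + b0 * t)" for t
    proof -
      have "a + b0 * t = (\<xi> 0 + b0 * t) + 2 * of_int m" using True by simp
      then show ?thesis by (simp only: tri_add_even)
    qed
    with ab show thesis by (metis that)
  next
    case False
    have "tri (a + b0 * t) = tri (\<xi> 0 + (- b0) * t)" for t
    proof -
      have "a + b0 * t = - (\<xi> 0 + (- b0) * t) + 2 * of_int m" using False m by simp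
      then show ?thesis by (simp only: tri_add_even tri_minus)
    qed
    with ab show thesis by (metis that)
  qed
  show ?thesis
  proof (cases "\<xi> 0 = 0")
    case True
    \<comment> \<open>Commutation at 1, where the tent map is 0, forces 2 b to be an even
      integer.\<close>
    have "tri (2 * b) = tri 0"
      using comm[of 1] b[of 1] True range[of 1] tent_tri[of b] by (simp add: tent_def tri_id)
    then obtain n :: int where "2 * b = 0 + 2 * of_int n \<or> 2 * b = - 0 + 2 * of_int n"
      by (rule tri_eqD)
    then have n: "b = of_int n" by simp
    \<comment> \<open>Evenness of \<open>tri\<close> makes the sign of \<open>b\<close> irrelevant;
      k = 0 is the constant solution 0.\<close>
    define k where "k = nat \<bar>n\<bar>"
    have k: "real k = \<bar>b\<bar>" by (simp add: k_def n)
    have xi: "\<xi> t = zigzag k t" if "t \<in> {0..1}" for t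
      using b[of t] that True tri_minus[of "b * t"] by (cases "b \<ge> 0") (auto simp: zigzag_eq_tri k)
    show ?thesis
    proof (cases "k = 0")
      case True
      then show ?thesis using xi by (auto simp: zigzag_def)
    next
      case False
      then show ?thesis using xi by (intro disjI1 exI[of _ k]) auto
    qed
  next
    case False
    then have p: "\<xi> 0 = 2 / 3" using value_0 by blast
    have "b = 0"
    proof (rule ccontr)
      assume "b \<noteq> 0"
      \<comment> \<open>The bound 1/4 puts \<open>t\<close> on the rising branch; |b t| at most 1/12
        keeps 2/3 + 2 b t in [1/2,5/6], where \<open>tri\<close> is the identity. There the tent map
        has slope -2, so commutation gives 2 b t = -2 b t.\<close>
      define t where "t = min (1 / 4) (1 / (12 * \<bar>b\<bar>))"
      have t: "0 < t" "t \<le> 1 / 4" using \<open>b \<noteq> 0\<close> by (auto simp: t_def)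
      have "\<bar>b\<bar> * t \<le> \<bar>b\<bar> * (1 / (12 * \<bar>b\<bar>))"
        by (intro mult_left_mono) (auto simp: t_def)
      then have bt: "\<bar>b * t\<bar> \<le> 1 / 12" using t \<open>b \<noteq> 0\<close> by (simp add: abs_mult)
      have "\<xi> t = 2 / 3 + b * t" "\<xi> (2 * t) = 2 / 3 + 2 * (b * t)"
        using b[of t] b[of "2 * t"] t bt p by (auto simp: tri_id abs_le_iff)
      then have "b * t = 0"
        using comm[of t] t bt by (auto simp: tent_def abs_le_iff split: if_splits)
      then show False using \<open>b \<noteq> 0\<close> t by simp
    qed
    then have "\<forall>x\<in>{0..1}. \<xi> x = 2 / 3" using b p by (simp add: tri_id)
    then show ?thesis by blast
  qed
qed

end

theorem theorem1:
  shows "(\<forall>\<xi> :: real \<Rightarrow> real.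
            \<xi> \<in> {0..1} \<rightarrow> {0..1} \<longrightarrow>
            continuous_on {0..1} \<xi> \<longrightarrow>
            (\<forall>x\<in>{0..1}. (\<xi> \<circ> tent) x = (tent \<circ> \<xi>) x) \<longrightarrow>
              (\<exists>k::nat. k \<ge> 1 \<and> (\<forall>x\<in>{0..1}. \<xi> x = zigzag k x)) \<or>
              (\<exists>x0::real. (x0 = 0 \<or> x0 = 2/3) \<and> (\<forall>x\<in>{0..1}. \<xi> x = x0)))
       \<and> (\<forall>k::nat. k \<ge> 1 \<longrightarrow>
            zigzag k \<in> {0..1} \<rightarrow> {0..1} \<and>
            (\<forall>x\<in>{0..1}. (zigzag k \<circ> tent) x = (tent \<circ> zigzag k) x))"
proof (intro conjI allI impI)
  fix \<xi> :: "real \<Rightarrow> real"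
  assume "\<xi> \<in> {0..1} \<rightarrow> {0..1}" "continuous_on {0..1} \<xi>"
    "\<forall>x\<in>{0..1}. (\<xi> \<circ> tent) x = (tent \<circ> \<xi>) x"
  then interpret tent_commuting \<xi>
    by unfold_locales auto
  show "(\<exists>k::nat. k \<ge> 1 \<and> (\<forall>x\<in>{0..1}. \<xi> x = zigzag k x)) \<or>
        (\<exists>x0::real. (x0 = 0 \<or> x0 = 2/3) \<and> (\<forall>x\<in>{0..1}. \<xi> x = x0))"
    by (rule classification)
next
  fix k :: nat
  show "zigzag k \<in> {0..1} \<rightarrow> {0..1}"
    by (simp add: zigzag_eq_tri tri_nonneg tri_le_1)
  show "\<forall>x\<in>{0..1}. (zigzag k \<circ> tent) x = (tent \<circ> zigzag k) x"
    by (simp add: zigzag_tent)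
qed

end
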